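(* Consider the system of ordinary differential equations, for $i\in\{1,\ldots,n\}$ and $t\ge0$, $$\begin{aligned} \dot X_{li} &= \Lambda^2_iB_{vi}^{\rm T},\\ \dot Y_{vi} &= -A_{li}^{\rm T}(A_{li}Y_{vi}-[F_{vi}]_{\rm R}-U_i)-[I_{r_i}]_{\rm C}\Lambda^2_i,\\ \dot U_i &= A_{li}Y_{vi}-[F_{vi}]_{\rm R}-U_i-\Lambda^1_i,\\ \dot W_i &= \sum_{j=1}^n a_{i,j}(\Lambda^1_i-\Lambda^1_j),\qquad \dot Z_i = \sum_{j=1}^n a_{i,j}(\Lambda^2_i-\Lambda^2_j),\\ \dot\Lambda^1_i &= U_i+\dot U_i-\sum_{j=1}^n a_{i,j}(W_i-W_j)-\sum_{j=1}^n a_{i,j}(\Lambda^1_i-\Lambda^1_j),\\ \dot\Lambda^2_i &= [Y_{vi}]_{\rm R}+[\dot Y_{vi}]_{\rm R}-X_{li}B_{vi}-\sum_{j=1}^n a_{i,j}(Z_i-Z_j)-\sum_{j=1}^n a_{i,j}(\Lambda^2_i-\Lambda^2_j)-\dot X_{li}B_{vi}, \end{aligned}$$ where $\dot X_{li},\dot Y_{vi},\dot U_i$ on the right-hand sides stand for the expressions in the first three lines, with state variables $X_{li}\in\mathbb R^{r\times p_i}$, $Y_{vi}\in\mathbb R^{r_i\times q}$, $U_i,W_i,\Lambda^1_i\in\mathbb R^{m\times q}$, $Z_i,\Lambda^2_i\in\mathbb R^{r\times q}$ and arbitrary initial conditions. If the undirected graph $\mathcal G$ is connected, then: 1) every equilibrium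 of this system is Lyapunov stable, and its trajectory is bounded for any initial condition; 2) the trajectory of this system is exponentially convergent, and $X(t)=[X_{l1}(t),\ldots,X_{ln}(t)]\in\mathbb R^{r\times p}$ converges exponentially to a least squares solution of the matrix equation $AXB=F$.
   Context: $A\in\mathbb R^{m\times r}$, $B\in\mathbb R^{p\times q}$, $F\in\mathbb R^{m\times q}$ are partitioned (Column-Row-Row structure) as $A=[A_{l1},\ldots,A_{ln}]$, $B=[B_{v1}^{\rm T},\ldots,B_{vn}^{\rm T}]^{\rm T}$, $F=[F_{v1}^{\rm T},\ldots,F_{vn}^{\rm T}]^{\rm T}$ with $A_{li}\in\mathbb R^{m\times r_i}$, $B_{vi}\in\mathbb R^{p_i\times q}$, $F_{vi}\in\mathbb R^{m_i\times q}$, $\sum_i r_i=r$, $\sum_i p_i=p$, $\sum_i m_i=m$. Augmented matrices: for $M\in\mathbb R^{r_i\times q}$ (such as $Y_{vi}$ or $\dot Y_{vi}$), $[M]_{\rm R}\in\mathbb R^{r\times q}$ has $i$th row-block (partition $r_1,\ldots,r_n$) equal to $M$ and zeros elsewhere; $[F_{vi}]_{\rm R}\in\mathbb R^{m\times q}$ has $i$th row-block (partition $m_1,\ldots,m_n$) equal to $F_{vi}$ and zeros elsewhere; $[I_{r_i}]_{\rm C}\in\mathbb R^{r_i\times r}$ has $i$th column-block (partition $r_1,\ldots,r_n$) equal to $I_{r_i}$ and zeros elsewhere. $\mathcal G$ is an undirected graph on $\{1,\ldots,n\}$ with symmetric adjacency matrix $[a_{i,j}]$, $a_{i,j}=a_{j,i}>0$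 if $\{j,i\}$ is an edge and $a_{i,j}=0$ otherwise. A least squares solution to $AXB=F$ is a minimizer of $\|AXB-F\|_{\rm F}^2$ over $X\in\mathbb R^{r\times p}$. An equilibrium $z$ is Lyapunov stable if for every $\epsilon>0$ there is $\delta>0$ such that every solution starting in the open ball of radius $\delta$ about $z$ stays in the open ball of radius $\epsilon$ about $z$ for all $t\ge0$. A trajectory converges exponentially to $z^*$ if its distance to $z^*$ is at most $c\,e^{-\mu t}$ for some $c\ge0$, $\mu>0$ and all $t\ge0$; "exponentially convergent" means converging exponentially to some equilibrium (possibly depending on the initial condition). *)

theory Defs
  imports "HOL-Analysis.Analysis"
begin

text \<open>
  The row and column index sets of the matrices are finite types, and a partition of such an index
  set into \<open>n\<close> blocks is a labelling \<open>\<beta>\<close> of the indices by elements of the finite type \<open>'n\<close>; block \<open>i\<close>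
  consists of the indices with label \<open>i\<close> (so \<open>r\<^sub>i\<close> is the number of indices with \<open>\<rho> c = i\<close>, and
  \<open>\<Sum>\<^sub>i r\<^sub>i = r\<close> holds by construction).  Since the \<open>n\<close> block sizes may differ, a block is represented by its
  zero-padded version in the full format.  For \<open>A\<^sub>l\<^sub>i\<close>, \<open>B\<^sub>v\<^sub>i\<close> and \<open>X\<^sub>l\<^sub>i\<close> the added zeros do not affect the
  products in which the block occurs; for \<open>F\<^sub>v\<^sub>i\<close> and \<open>Y\<^sub>v\<^sub>i\<close> the padded block is
  the augmented matrix \<open>[F\<^sub>v\<^sub>i]\<^sub>R\<close>, \<open>[Y\<^sub>v\<^sub>i]\<^sub>R\<close>.
\<close>

definition row_block :: "('k::finite \<Rightarrow> 'n::finite) \<Rightarrow> 'n \<Rightarrow> real^'q^'k \<Rightarrow> real^'q^'k" where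
  "row_block \<beta> i M = (\<chi> c b. if \<beta> c = i then M $ c $ b else 0)"

definition col_block :: "('k::finite \<Rightarrow> 'n::finite) \<Rightarrow> 'n \<Rightarrow> real^'k^'m \<Rightarrow> real^'k^'m" where
  "col_block \<beta> i M = (\<chi> a c. if \<beta> c = i then M $ a $ c else 0)"

text \<open>
  States \<open>(X, Y, U, W, Z, \<Lambda>\<^sup>1, \<Lambda>\<^sup>2)\<close>.  The blocks \<open>X\<^sub>l\<^sub>i\<close> are stored side by side as
  \<open>X = [X\<^sub>l\<^sub>1, \<dots>, X\<^sub>l\<^sub>n]\<close> (column blocks) and the blocks \<open>Y\<^sub>v\<^sub>i\<close> on top of each other as one matrix \<open>Y\<close>
  (row blocks); the other components are families indexed by \<open>i\<close>.  The norm of this type is the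
  square root of the sum of the squares of all real entries.
\<close>

type_synonym ('m, 'r, 'p, 'q, 'n) state =
  "(real^'p^'r) \<times> (real^'q^'r) \<times> (real^'q^'m^'n) \<times> (real^'q^'m^'n) \<times> (real^'q^'r^'n) \<times>
   (real^'q^'m^'n) \<times> (real^'q^'r^'n)"

text \<open>
  Right-hand side of the system.  Below, \<open>dX i\<close> and \<open>dY i\<close> are the (padded) derivatives of \<open>X\<^sub>l\<^sub>i\<close> and
  \<open>Y\<^sub>v\<^sub>i\<close>; they vanish outside block \<open>i\<close>, so that summation over \<open>i\<close> assembles the derivatives of the
  full matrices.  The product \<open>[I]\<^sub>C \<Lambda>\<^sup>2\<^sub>i\<close> selects the \<open>i\<close>th row block of \<open>\<Lambda>\<^sup>2\<^sub>i\<close>.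
\<close>

definition crr_field ::
  "real^'r^'m \<Rightarrow> real^'q^'p \<Rightarrow> real^'q^'m \<Rightarrow> ('r \<Rightarrow> 'n) \<Rightarrow> ('p \<Rightarrow> 'n) \<Rightarrow> ('m \<Rightarrow> 'n) \<Rightarrow>
   ('n \<Rightarrow> 'n \<Rightarrow> real) \<Rightarrow>
   ('m::finite, 'r::finite, 'p::finite, 'q::finite, 'n::finite) state \<Rightarrow> ('m, 'r, 'p, 'q, 'n) state"
  where
  "crr_field A B F \<rho> \<pi> \<phi> a = (\<lambda>(X, Y, U, W, Z, \<Lambda>1, \<Lambda>2).
    let
      Al = (\<lambda>i. col_block \<rho> i A);
      Bv = (\<lambda>i. row_block \<pi> i B);
      Fv = (\<lambda>i. row_block \<phi> i F);
      Xl = (\<lambda>i. col_block \<pi> i X);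
      Yv = (\<lambda>i. row_block \<rho> i Y);
      dX = (\<lambda>i. \<Lambda>2 $ i ** transpose (Bv i));
      dY = (\<lambda>i. - (transpose (Al i) ** (Al i ** Yv i - Fv i - U $ i)) - row_block \<rho> i (\<Lambda>2 $ i));
      dU = (\<lambda>i. Al i ** Yv i - Fv i - U $ i - \<Lambda>1 $ i)
    in
     (\<Sum>i\<in>UNIV. dX i,
      \<Sum>i\<in>UNIV. dY i,
      \<chi> i. dU i,
      \<chi> i. \<Sum>j\<in>UNIV. a i j *\<^sub>R (\<Lambda>1 $ i - \<Lambda>1 $ j),
      \<chi> i. \<Sum>j\<in>UNIV. a i j *\<^sub>R (\<Lambda>2 $ i - \<Lambda>2 $ j),
      \<chi> i. U $ i + dU i - (\<Sum>j\<in>UNIV. a i j *\<^sub>R (W $ i - W $ j))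
             - (\<Sum>j\<in>UNIV. a i j *\<^sub>R (\<Lambda>1 $ i - \<Lambda>1 $ j)),
      \<chi> i. Yv i + dY i - Xl i ** Bv i - (\<Sum>j\<in>UNIV. a i j *\<^sub>R (Z $ i - Z $ j))
             - (\<Sum>j\<in>UNIV. a i j *\<^sub>R (\<Lambda>2 $ i - \<Lambda>2 $ j)) - dX i ** Bv i))"

definition ode_solution :: "('s::real_normed_vector \<Rightarrow> 's) \<Rightarrow> (real \<Rightarrow> 's) \<Rightarrow> bool" where
  "ode_solution f x \<longleftrightarrow> (\<forall>t\<ge>0. (x has_vector_derivative f (x t)) (at t within {0..}))"

definition equilibrium :: "('s::real_normed_vector \<Rightarrow> 's) \<Rightarrow> 's \<Rightarrow> bool" where
  "equilibrium f z \<longleftrightarrow> f z = 0"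

definition lyapunov_stable :: "('s::real_normed_vector \<Rightarrow> 's) \<Rightarrow> 's \<Rightarrow> bool" where
  "lyapunov_stable f z \<longleftrightarrow>
    (\<forall>\<epsilon>>0. \<exists>\<delta>>0. \<forall>x. ode_solution f x \<and> x 0 \<in> ball z \<delta> \<longrightarrow> (\<forall>t\<ge>0. x t \<in> ball z \<epsilon>))"

definition converges_exponentially :: "(real \<Rightarrow> 's::metric_space) \<Rightarrow> 's \<Rightarrow> bool" where
  "converges_exponentially x z \<longleftrightarrow>
    (\<exists>c\<ge>0. \<exists>\<mu>>0. \<forall>t\<ge>0. dist (x t) z \<le> c * exp (- \<mu> * t))"

text \<open>The norm on \<open>real^'q^'m\<close> is the Frobenius norm.\<close>

definition least_squares_solution ::
  "real^'r^'m \<Rightarrow> real^'q^'p \<Rightarrow> real^'q^'m \<Rightarrow> real^'p^'r \<Rightarrow> bool" where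
  "least_squares_solution A B F = is_arg_min (\<lambda>X. (norm (A ** X ** B - F))\<^sup>2) (\<lambda>_. True)"

definition undirected_graph :: "'n set set \<Rightarrow> bool" where
  "undirected_graph E \<longleftrightarrow> (\<forall>e\<in>E. \<exists>i j. i \<noteq> j \<and> e = {i, j})"

definition adjacency_matrix :: "'n set set \<Rightarrow> ('n \<Rightarrow> 'n \<Rightarrow> real) \<Rightarrow> bool" where
  "adjacency_matrix E a \<longleftrightarrow>
    (\<forall>i j. a i j = a j i \<and> (if {j, i} \<in> E then a i j > 0 else a i j = 0))"

definition connected_graph :: "'n set set \<Rightarrow> bool" where
  "connected_graph E \<longleftrightarrow> (\<forall>i j. (i, j) \<in> {(u, v). {u, v} \<in> E}\<^sup>*)"

end

theory Submission
  imports Defs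
begin

text \<open>
  The system is affine, with linear part \<open>M\<close>.  Let \<open>T e\<close> be the deviation of \<open>A\<^sub>l\<^sub>i Y\<^sub>v\<^sub>i - U\<^sub>i\<close>.  Along
  deviations \<open>e\<close> from an equilibrium, the energy \<open>|e|\<^sup>2 + |T e|\<^sup>2\<close> decreases at twice the rate
  \<open>q e = |X'|\<^sup>2 + |Y'|\<^sup>2 + |U'|\<^sup>2 + |T e|\<^sup>2 + \<Lambda>\<^sup>1 \<bullet> L \<Lambda>\<^sup>1 + \<Lambda>\<^sup>2 \<bullet> L \<Lambda>\<^sup>2\<close> with \<open>L\<close> the graph Laplacian, which yields
  stability and boundedness.  If \<open>q e\<close> and \<open>q (M e)\<close> both vanish then so does \<open>M (M e)\<close>; as
  dissipativity excludes Jordan blocks at 0, \<open>q e + q (M e)\<close> is positive definite on the range of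
  \<open>M\<close>.  Hence the velocity, which lies in this range, decays exponentially, and the trajectory
  converges to an equilibrium.  At an equilibrium the multipliers agree across the graph, and summing
  the equations over the nodes gives the normal equations \<open>A\<^sup>T (A X B - F) B\<^sup>T = 0\<close>.
\<close>

section \<open>Dissipative linear systems\<close>

text \<open>Differential Gronwall inequality: the integrating factor \<open>exp (\<mu> * t)\<close>
  turns the hypothesis into monotonicity of \<open>g\<close>. The case \<open>\<mu> = 0\<close>
  later shows that the energy does not increase.\<close>

lemma real_exponential_decay:
  fixes h h' :: "real \<Rightarrow> real"
  assumes d: "\<And>t. t \<ge> 0 \<Longrightarrow> (h has_vector_derivative h' t) (at t within {0..})"
    and le: "\<And>t. t \<ge> 0 \<Longrightarrow> h' t \<le> - \<mu> * h t"
    and t: "t \<ge> 0"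
  shows "h t \<le> h 0 * exp (- \<mu> * t)"
proof -
  define g where "g = (\<lambda>t. exp (\<mu> * t) * h t)"
  have dg: "(g has_real_derivative exp (\<mu> * s) * (\<mu> * h s + h' s)) (at s within {0..})" if "s \<ge> 0" for s
    unfolding g_def
    by (rule derivative_eq_intros d[OF that, folded has_real_derivative_iff_has_vector_derivative] refl)+
       (simp add: algebra_simps)
  have "g t \<le> g 0"
  proof (rule DERIV_nonpos_imp_decreasing_open[OF t])
    fix s :: real assume s: "0 < s" "s < t"
    \<comment> \<open>Interior points have two-sided derivatives; the endpoint 0 enters only through
      continuity of \<open>g\<close>.\<close>
    have "at s within {0..} = at s"
      by (rule at_within_interior) (use s in \<open>simp add: interior_real_atLeast\<close>)
    then have "DERIV g s :> exp (\<mu> * s) * (\<mu> * h s + h' s)" using dg[of s] s by simp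
    moreover have "exp (\<mu> * s) * (\<mu> * h s + h' s) \<le> 0"
      using le[of s] s by (intro mult_nonneg_nonpos) auto
    ultimately show "\<exists>y. DERIV g s :> y \<and> y \<le> 0" by blast
  next
    have "continuous_on {0..} g"
      by (rule DERIV_continuous_on) (use dg in auto)
    then show "continuous_on {0..t} g" by (rule continuous_on_subset) auto
  qed
  then show ?thesis by (simp add: g_def exp_minus field_simps)
qed

text \<open>The minimum of \<open>q\<close> over the compact unit sphere of \<open>S\<close> is
  positive, and homogeneity of degree two carries it to all of \<open>S\<close>.\<close>

lemma pos_def_lower_bound:
  fixes q :: "'s::euclidean_space \<Rightarrow> real"
  assumes "subspace S" and cont: "continuous_on UNIV q"
    and hom: "\<And>c y. q (c *\<^sub>R y) = c\<^sup>2 * q y"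
    and pos: "\<And>y. y \<in> S \<Longrightarrow> y \<noteq> 0 \<Longrightarrow> q y > 0"
  obtains c where "c > 0" "\<And>y. y \<in> S \<Longrightarrow> c * (norm y)\<^sup>2 \<le> q y"
proof -
  let ?K = "S \<inter> sphere 0 1"
  have comp: "compact ?K"
    using closed_subspace[OF assms(1)] by (simp add: closed_Int_compact)
  have "\<exists>c>0. \<forall>y\<in>?K. c \<le> q y"
  proof (cases "?K = {}")
    case True
    \<comment> \<open>Here \<open>S\<close> is trivial and the bound on its sphere is vacuous, so
      any positive constant serves.\<close>
    then show ?thesis by (intro exI[of _ 1]) auto
  next
    case False
    obtain u where u: "u \<in> ?K" "\<forall>y\<in>?K. q u \<le> q y"
      using continuous_attains_inf[OF comp False continuous_on_subset[OF cont subset_UNIV]] by blast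
    then have "q u > 0" by (intro pos) auto
    with u show ?thesis by blast
  qed
  then obtain c where c: "c > 0" "\<forall>y\<in>?K. c \<le> q y" by blast
  have "c * (norm y)\<^sup>2 \<le> q y" if y: "y \<in> S" for y
  proof (cases "y = 0")
    case True
    then show ?thesis using hom[of 0 0] by simp
  next
    case False
    have "y /\<^sub>R norm y \<in> ?K"
      using False y assms(1) by (simp add: subspace_scale)
    with c have "(norm y)\<^sup>2 * c \<le> (norm y)\<^sup>2 * q (y /\<^sub>R norm y)"
      by (intro mult_left_mono) auto
    also have "\<dots> = q (norm y *\<^sub>R (y /\<^sub>R norm y))" by (simp only: hom)
    finally show ?thesis using False by (simp add: mult.commute)
  qed
  with c that show ?thesis by blast
qed

section \<open>Energy decay for linear systems\<close>

text \<open>Dissipativity refers to the inner product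
  \<open>x \<bullet> y + T x \<bullet> T y\<close>. The condition \<open>observable\<close> is of
  LaSalle type, but inspects only the two points \<open>e\<close> and \<open>M e\<close>.\<close>

locale dissipative_system =
  fixes M :: "'s::euclidean_space \<Rightarrow> 's" and T :: "'s \<Rightarrow> 't::euclidean_space"
  assumes linM: "linear M" and linT: "linear T"
    and dissipative: "e \<bullet> M e + T e \<bullet> T (M e) \<le> 0"
    and observable: "e \<bullet> M e + T e \<bullet> T (M e) = 0 \<Longrightarrow>
      M e \<bullet> M (M e) + T (M e) \<bullet> T (M (M e)) = 0 \<Longrightarrow> M (M e) = 0"
begin

definition energy :: "'s \<Rightarrow> real" where
  "energy e = e \<bullet> e + T e \<bullet> T e"

definition dissipation :: "'s \<Rightarrow> real" where
  "dissipation e = - (e \<bullet> M e + T e \<bullet> T (M e))"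

lemma dissipation_nonneg: "dissipation e \<ge> 0"
  using dissipative[of e] by (simp add: dissipation_def)

lemma energy_ge: "(norm e)\<^sup>2 \<le> energy e"
  by (simp add: energy_def power2_norm_eq_inner)

lemma energy_le:
  obtains C where "C > 0" "\<And>e. energy e \<le> C * (norm e)\<^sup>2"
proof -
  obtain K where K: "K > 0" "\<And>e. norm (T e) \<le> K * norm e"
    using linear_bounded_pos[OF linT] by blast
  have "energy e \<le> (1 + K\<^sup>2) * (norm e)\<^sup>2" for e
    using power_mono[OF K(2)[of e], of 2]
    by (simp add: energy_def power2_norm_eq_inner power_mult_distrib algebra_simps)
  moreover have "1 + K\<^sup>2 > 0" using K by (simp add: add_pos_pos)
  ultimately show ?thesis using that by blast
qed

lemma energy_derivative:
  assumes "(e has_vector_derivative M (e t)) (at t within S)"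
  shows "((\<lambda>t. energy (e t)) has_vector_derivative - 2 * dissipation (e t)) (at t within S)"
proof -
  have "((\<lambda>t. T (e t)) has_vector_derivative T (M (e t))) (at t within S)"
    using linT assms by (simp add: bounded_linear.has_vector_derivative linear_linear)
  from has_vector_derivative_add[OF
      bounded_bilinear.has_vector_derivative[OF bounded_bilinear_inner assms assms]
      bounded_bilinear.has_vector_derivative[OF bounded_bilinear_inner this this]]
  show ?thesis by (simp add: energy_def dissipation_def inner_commute algebra_simps)
qed

lemma energy_nonincreasing:
  assumes "\<And>t. t \<ge> 0 \<Longrightarrow> (e has_vector_derivative M (e t)) (at t within {0..})" and "t \<ge> 0"
  shows "energy (e t) \<le> energy (e 0)"
  using real_exponential_decay[where \<mu> = 0, OF energy_derivative[OF assms(1)] _ assms(2)]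
    dissipation_nonneg by simp

text \<open>A Jordan block of size two at 0 would let \<open>e + s *\<^sub>R M e\<close> grow in energy.\<close>

lemma kernel_square:
  assumes "M (M e) = 0"
  shows "M e = 0"
proof (rule ccontr)
  assume nz: "M e \<noteq> 0"
  define c where "c = energy (M e)"
  define k where "k = e \<bullet> M e + T e \<bullet> T (M e)"
  have "c > 0" unfolding c_def using nz energy_ge[of "M e"] by (smt (verit) zero_less_norm_iff zero_less_power)
  \<comment> \<open>Since \<open>M (M e) = 0\<close>, the term quadratic in \<open>s\<close>
    vanishes; an affine function of slope \<open>c > 0\<close> remains, and the \<open>s\<close>
    chosen next gives it the value 1.\<close>
  have "k + s * c \<le> 0" for s
    using dissipative[of "e + s *\<^sub>R M e"] assms
    by (simp add: linear_add[OF linM] linear_scale[OF linM] linear_add[OF linT] linear_scale[OF linT]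
        inner_add_left c_def k_def energy_def algebra_simps)
  from this[of "(1 - k) / c"] \<open>c > 0\<close> show False by simp
qed

text \<open>If both terms vanish at \<open>y = M u\<close>, then \<open>M (M y) = 0\<close>, and
  \<open>kernel_square\<close> applied first to \<open>y\<close> and then to \<open>u\<close> gives
  \<open>y = 0\<close>. On the kernel of \<open>M\<close> both terms vanish, hence the restriction
  to the range.\<close>

lemma coercive:
  obtains \<kappa> where "\<kappa> > 0" "\<And>y. y \<in> range M \<Longrightarrow> \<kappa> * (norm y)\<^sup>2 \<le> dissipation y + dissipation (M y)"
proof (rule pos_def_lower_bound[of "range M" "\<lambda>y. dissipation y + dissipation (M y)"])
  show "subspace (range M)" using linM by (simp add: linear_subspace_image)
  show "continuous_on UNIV (\<lambda>y. dissipation y + dissipation (M y))"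
    unfolding dissipation_def
    by (intro continuous_intros linear_continuous_on_compose[OF _ linM] linear_continuous_on_compose[OF _ linT])
  show "dissipation (c *\<^sub>R y) + dissipation (M (c *\<^sub>R y)) = c\<^sup>2 * (dissipation y + dissipation (M y))" for c y
    by (simp add: dissipation_def linear_scale[OF linM] linear_scale[OF linT] power2_eq_square algebra_simps)
  show "dissipation y + dissipation (M y) > 0" if "y \<in> range M" "y \<noteq> 0" for y
  proof (rule ccontr)
    assume "\<not> ?thesis"
    with dissipation_nonneg[of y] dissipation_nonneg[of "M y"] have "dissipation y = 0" "dissipation (M y) = 0" by linarith+
    then have "M (M y) = 0" using observable[of y] by (simp add: dissipation_def)
    with that kernel_square show False by blast
  qed
qed (use that in blast)

text \<open>The Lyapunov function is \<open>energy y + energy (M y)\<close>: as \<open>M y\<close>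
  solves the same equation, its dissipation is the form bounded below in \<open>coercive\<close>.
  The constants are uniform over all solutions in the range.\<close>

lemma derivative_decay:
  obtains C \<mu> where "C > 0" "\<mu> > 0"
    "\<And>y t. (\<And>t. t \<ge> 0 \<Longrightarrow> y t \<in> range M \<and> (y has_vector_derivative M (y t)) (at t within {0..}))
      \<Longrightarrow> t \<ge> 0 \<Longrightarrow> norm (y t) \<le> C * norm (y 0) * exp (- \<mu> * t)"
proof -
  obtain \<kappa> where \<kappa>: "\<kappa> > 0" "\<And>y. y \<in> range M \<Longrightarrow> \<kappa> * (norm y)\<^sup>2 \<le> dissipation y + dissipation (M y)"
    using coercive by blast
  obtain c where c: "c > 0" "\<And>e. energy e \<le> c * (norm e)\<^sup>2" using energy_le by blast
  obtain K where K: "K > 0" "\<And>e. norm (M e) \<le> K * norm e"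
    using linear_bounded_pos[OF linM] by blast
  define D where "D = c * (1 + K\<^sup>2)"
  have "D > 0" using c K by (simp add: D_def add_pos_pos)
  have total: "energy y + energy (M y) \<le> D * (norm y)\<^sup>2" for y
  proof -
    have "c * (norm (M y))\<^sup>2 \<le> c * (K * norm y)\<^sup>2"
      using K(2)[of y] c(1) by (intro mult_left_mono power_mono) auto
    with c(2)[of y] c(2)[of "M y"] show ?thesis by (simp add: D_def power_mult_distrib algebra_simps)
  qed
  \<comment> \<open>The Lyapunov function \<open>h\<close> satisfies \<open>h' \<le> - 2 * \<kappa>
    * (norm y)\<^sup>2 \<le> - 2 * (\<kappa> / D) * h\<close>, so it decays at rate
    \<open>2 * \<mu>\<close>; the square root halves this rate.\<close>
  define \<mu> where "\<mu> = \<kappa> / D"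
  have "\<mu> > 0" using \<kappa> \<open>D > 0\<close> by (simp add: \<mu>_def)
  have "norm (y t) \<le> sqrt D * norm (y 0) * exp (- \<mu> * t)"
    if y: "\<And>t. t \<ge> 0 \<Longrightarrow> y t \<in> range M \<and> (y has_vector_derivative M (y t)) (at t within {0..})"
      and t: "t \<ge> 0" for y t
  proof -
    define h where "h = (\<lambda>t. energy (y t) + energy (M (y t)))"
    have dM: "((\<lambda>t. M (y t)) has_vector_derivative M (M (y t))) (at t within {0..})" if "t \<ge> 0" for t
      using linM y[OF that] by (simp add: bounded_linear.has_vector_derivative linear_linear)
    have dh: "(h has_vector_derivative (- 2 * dissipation (y t) + - 2 * dissipation (M (y t)))) (at t within {0..})"
      if "t \<ge> 0" for t
      unfolding h_def using y[OF that] dM[OF that]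
      by (intro has_vector_derivative_add energy_derivative) auto
    have "h t \<le> h 0 * exp (- (2 * \<mu>) * t)"
    proof (rule real_exponential_decay[OF dh _ t])
      fix s :: real assume s: "s \<ge> 0"
      have "\<mu> * h s \<le> \<mu> * (D * (norm (y s))\<^sup>2)"
        unfolding h_def using total \<open>\<mu> > 0\<close> by (intro mult_left_mono) auto
      also have "\<dots> = \<kappa> * (norm (y s))\<^sup>2" using \<open>D > 0\<close> by (simp add: \<mu>_def)
      also have "\<dots> \<le> dissipation (y s) + dissipation (M (y s))" using \<kappa>(2) y[OF s] by blast
      finally show "- 2 * dissipation (y s) + - 2 * dissipation (M (y s)) \<le> - (2 * \<mu>) * h s" by simp
    qed
    also have "\<dots> \<le> D * (norm (y 0))\<^sup>2 * exp (- (2 * \<mu>) * t)"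
      unfolding h_def using total by (intro mult_right_mono) auto
    also have "\<dots> = (sqrt D * norm (y 0) * exp (- \<mu> * t))\<^sup>2"
      using \<open>D > 0\<close> by (simp add: power_mult_distrib exp_double[symmetric])
    finally have "(norm (y t))\<^sup>2 \<le> (sqrt D * norm (y 0) * exp (- \<mu> * t))\<^sup>2"
      using energy_ge[of "y t"] energy_ge[of "M (y t)"] zero_le_power2[of "norm (M (y t))"]
      unfolding h_def by linarith
    then show ?thesis by (rule power2_le_imp_le) (use \<open>D > 0\<close> in auto)
  qed
  then show ?thesis
    using \<open>D > 0\<close> \<open>\<mu> > 0\<close> by (intro that[of "sqrt D" \<mu>]) auto
qed

end

section \<open>Affine systems: stability, boundedness and exponential convergence\<close>

locale dissipative_affine_system = dissipative_system M T
  for M :: "'s::euclidean_space \<Rightarrow> 's" and T :: "'s \<Rightarrow> 't::euclidean_space" +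
  fixes f :: "'s \<Rightarrow> 's" and z0 :: 's
  assumes affine: "f z - f z' = M (z - z')" and equilibrium_z0: "equilibrium f z0"
begin

lemma field_eq: "equilibrium f z \<Longrightarrow> f y = M (y - z)"
  using affine[of y z] by (simp add: equilibrium_def)

lemma deviation_derivative:
  assumes "ode_solution f x" "equilibrium f z" "t \<ge> 0"
  shows "((\<lambda>t. x t - z) has_vector_derivative M (x t - z)) (at t within {0..})"
  using assms has_vector_derivative_diff_const[of x z "f (x t)"]
  by (simp add: ode_solution_def field_eq)

text \<open>The energy of the deviation does not increase and is comparable to the squared norm. As
  \<open>C\<close> depends neither on the solution nor on the equilibrium, Lyapunov stability and
  boundedness both follow.\<close>

lemma deviation_bound:
  obtains C where "C > 0"
    "\<And>x z t. ode_solution f x \<Longrightarrow> equilibrium f z \<Longrightarrow> t \<ge> 0 \<Longrightarrow> dist (x t) z \<le> C * dist (x 0) z"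
proof -
  obtain c where c: "c > 0" "\<And>e. energy e \<le> c * (norm e)\<^sup>2" using energy_le by blast
  have "dist (x t) z \<le> sqrt c * dist (x 0) z"
    if "ode_solution f x" "equilibrium f z" "t \<ge> 0" for x z t
  proof -
    have "(norm (x t - z))\<^sup>2 \<le> energy (x t - z)" by (rule energy_ge)
    also have "\<dots> \<le> energy (x 0 - z)"
      using energy_nonincreasing[OF deviation_derivative[OF that(1,2)] that(3)] .
    also have "\<dots> \<le> c * (norm (x 0 - z))\<^sup>2" by (rule c)
    also have "\<dots> = (sqrt c * norm (x 0 - z))\<^sup>2" using c by (simp add: power_mult_distrib)
    finally show ?thesis
      unfolding dist_norm by (rule power2_le_imp_le) (use c(1) in auto)
  qed
  then show ?thesis using c(1) by (intro that[of "sqrt c"]) auto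
qed

lemma stable:
  assumes "equilibrium f z"
  shows "lyapunov_stable f z"
  unfolding lyapunov_stable_def
proof (intro allI impI)
  fix \<epsilon> :: real assume "\<epsilon> > 0"
  obtain C where C: "C > 0"
    "\<And>x z t. ode_solution f x \<Longrightarrow> equilibrium f z \<Longrightarrow> t \<ge> 0 \<Longrightarrow> dist (x t) z \<le> C * dist (x 0) z"
    using deviation_bound by metis
  have "x t \<in> ball z \<epsilon>" if "ode_solution f x" "x 0 \<in> ball z (\<epsilon> / C)" "t \<ge> 0" for x t
  proof -
    have "C * dist (x 0) z < \<epsilon>" using that(2) C(1) by (simp add: dist_commute field_simps)
    with C(2)[OF that(1) assms that(3)] show ?thesis by (simp add: dist_commute)
  qed
  then show "\<exists>\<delta>>0. \<forall>x. ode_solution f x \<and> x 0 \<in> ball z \<delta> \<longrightarrow> (\<forall>t\<ge>0. x t \<in> ball z \<epsilon>)"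
    using \<open>\<epsilon> > 0\<close> \<open>C > 0\<close> by (intro exI[of _ "\<epsilon> / C"]) auto
qed

lemma bounded_solution:
  assumes "ode_solution f x"
  shows "bounded (x ` {0..})"
proof -
  obtain C where C: "C > 0"
    "\<And>x z t. ode_solution f x \<Longrightarrow> equilibrium f z \<Longrightarrow> t \<ge> 0 \<Longrightarrow> dist (x t) z \<le> C * dist (x 0) z"
    using deviation_bound by metis
  show ?thesis
    unfolding bounded_def using C(2)[OF assms equilibrium_z0]
    by (intro exI[of _ z0] exI[of _ "C * dist (x 0) z0"]) (auto simp: dist_commute)
qed

text \<open>With \<open>N\<close> a left inverse of \<open>M\<close> on its range, \<open>x - N (f x)\<close> is constant along a solution; this
  constant is the limit.\<close>

lemma exponential_convergence:
  assumes x: "ode_solution f x"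
  obtains z where "equilibrium f z" "converges_exponentially x z"
proof -
  have fz: "f z = M (z - z0)" for z using field_eq[OF equilibrium_z0] .
  have dx: "(x has_vector_derivative f (x t)) (at t within {0..})" if "t \<ge> 0" for t
    using x that by (simp add: ode_solution_def)
  have dfx: "((\<lambda>t. f (x t)) has_vector_derivative M (f (x t))) (at t within {0..})" if "t \<ge> 0" for t
    using bounded_linear.has_vector_derivative[OF _ deviation_derivative[OF x equilibrium_z0 that]] linM
    unfolding fz by (simp add: linear_linear)
  obtain C \<mu> where C: "C > 0" "\<mu> > 0"
    "\<And>y t. (\<And>t. t \<ge> 0 \<Longrightarrow> y t \<in> range M \<and> (y has_vector_derivative M (y t)) (at t within {0..}))
      \<Longrightarrow> t \<ge> 0 \<Longrightarrow> norm (y t) \<le> C * norm (y 0) * exp (- \<mu> * t)"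
    using derivative_decay by metis
  \<comment> \<open>The velocity \<open>f (x t) = M (x t - z0)\<close> lies in the range of
    \<open>M\<close> and itself solves \<open>y' = M y\<close>.\<close>
  have dec: "norm (f (x t)) \<le> C * norm (f (x 0)) * exp (- \<mu> * t)" if "t \<ge> 0" for t
    by (rule C(3)[of "\<lambda>t. f (x t)"]) (use dfx that in \<open>auto simp: fz\<close>)
  have sub: "subspace (range M)" using linM by (simp add: linear_subspace_image)
  \<comment> \<open>Equal images \<open>M (M u) = M (M v)\<close> give
    \<open>M (M (u - v)) = 0\<close>, to which \<open>kernel_square\<close> applies.\<close>
  have "inj_on M (range M)"
    using kernel_square linear_diff[OF linM] unfolding inj_on_def
    by (smt (verit) eq_iff_diff_eq_0 rangeE)
  then obtain N where N: "linear N" "\<And>y. y \<in> range M \<Longrightarrow> N (M y) = y"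
    using linear_exists_left_inverse_on[OF linM sub] by metis
  obtain K where K: "K > 0" "\<And>e. norm (N e) \<le> K * norm e"
    using linear_bounded_pos[OF N(1)] by blast
  define g where "g = (\<lambda>t. x t - N (f (x t)))"
  have "(g has_vector_derivative 0) (at t within {0..})" if "t \<ge> 0" for t
  proof -
    have "((\<lambda>t. N (f (x t))) has_vector_derivative N (M (f (x t)))) (at t within {0..})"
      using bounded_linear.has_vector_derivative[OF _ dfx[OF that]] N(1) by (simp add: linear_linear)
    from has_vector_derivative_diff[OF dx[OF that] this] show ?thesis
      by (simp add: g_def N(2) fz)
  qed
  then obtain z where z: "\<And>t. t \<ge> 0 \<Longrightarrow> g t = z"
    using has_vector_derivative_zero_constant[of "{0..}" g] by auto
  have bd: "dist (x t) z \<le> K * C * norm (f (x 0)) * exp (- \<mu> * t)" if "t \<ge> 0" for t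
  proof -
    have "dist (x t) z = norm (N (f (x t)))" using z[OF that] by (auto simp: g_def dist_norm)
    also have "\<dots> \<le> K * norm (f (x t))" by (rule K)
    also have "\<dots> \<le> K * (C * norm (f (x 0)) * exp (- \<mu> * t))"
      using dec[OF that] K(1) by (intro mult_left_mono) auto
    finally show ?thesis by (simp add: mult.assoc)
  qed
  have conv: "converges_exponentially x z"
    unfolding converges_exponentially_def using bd C K
    by (intro exI[of _ "K * C * norm (f (x 0))"] conjI exI[of _ \<mu>]) auto
  have e0: "((\<lambda>t. c * exp (- \<mu> * t)) \<longlongrightarrow> 0) at_top" for c :: real
    using \<open>\<mu> > 0\<close>
    by (intro tendsto_mult_right_zero filterlim_compose[OF exp_at_bot]
        filterlim_tendsto_neg_mult_at_bot[OF tendsto_const _ filterlim_ident]) simp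
  \<comment> \<open>The limit is an equilibrium: \<open>f (x t)\<close> and
    \<open>M (x t - z)\<close> both tend to 0, while their difference is constantly
    \<open>f z\<close>.\<close>
  have "((\<lambda>t. f (x t)) \<longlongrightarrow> 0) at_top"
    by (rule Lim_null_comparison[OF _ e0[of "C * norm (f (x 0))"]])
       (use dec in \<open>auto intro: eventually_mono[OF eventually_ge_at_top[of 0]]\<close>)
  moreover have "((\<lambda>t. x t - z) \<longlongrightarrow> 0) at_top"
    by (rule Lim_null_comparison[OF _ e0[of "K * C * norm (f (x 0))"]])
       (use bd in \<open>auto simp: dist_norm intro: eventually_mono[OF eventually_ge_at_top[of 0]]\<close>)
  then have "((\<lambda>t. M (x t - z)) \<longlongrightarrow> M 0) at_top"
    using bounded_linear.tendsto[of M] linM by (simp add: linear_linear)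
  ultimately have "((\<lambda>t. f (x t) - M (x t - z)) \<longlongrightarrow> 0) at_top"
    using tendsto_diff[of "\<lambda>t. f (x t)" 0] linear_0[OF linM] by fastforce
  moreover have "f (x t) - M (x t - z) = f z" for t using affine[of "x t" z] by (simp add: algebra_simps)
  ultimately have "f z = 0" by (simp add: tendsto_const_iff)
  then show ?thesis using that conv by (simp add: equilibrium_def)
qed

end

section \<open>Saddle point dynamics\<close>

text \<open>The dynamics of the Lagrangian
  \<open>(norm (G Y - c - U))\<^sup>2 / 2 + l \<bullet> (U - L1 W) + m \<bullet> (R Y - P X - L2 Z)\<close> with derivative feedback in the
  multipliers; a prime marks an adjoint.\<close>

locale saddle_system =
  fixes G :: "'y::euclidean_space \<Rightarrow> 'u::euclidean_space" and G'
    and R :: "'y \<Rightarrow> 'v::euclidean_space" and R'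
    and P :: "'x::euclidean_space \<Rightarrow> 'v" and P'
    and L1 :: "'u \<Rightarrow> 'u" and L2 :: "'v \<Rightarrow> 'v"
  assumes linear_ops: "linear G" "linear G'" "linear R" "linear R'" "linear P" "linear P'"
      "linear L1" "linear L2"
    and adjoint_G: "G y \<bullet> u = y \<bullet> G' u"
    and adjoint_R: "R y \<bullet> v = y \<bullet> R' v"
    and adjoint_P: "P x \<bullet> v = x \<bullet> P' v"
    and adjoint_L1: "L1 u \<bullet> u' = u \<bullet> L1 u'"
    and adjoint_L2: "L2 v \<bullet> v' = v \<bullet> L2 v'"
    and psd_L1: "u \<bullet> L1 u \<ge> 0" "u \<bullet> L1 u = 0 \<Longrightarrow> L1 u = 0"
    and psd_L2: "v \<bullet> L2 v \<ge> 0" "v \<bullet> L2 v = 0 \<Longrightarrow> L2 v = 0"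
begin

text \<open>The first five components descend along the gradient of the Lagrangian and
  \<open>l\<close>, \<open>m\<close> ascend. The terms \<open>U'\<close>, \<open>R Y'\<close> and
  \<open>- P X'\<close> feed back velocities, and \<open>- L1 l\<close>, \<open>- L2 m\<close> damp
  the multipliers.\<close>

definition saddle_field ::
  "'u \<Rightarrow> 'x \<times> 'y \<times> 'u \<times> 'u \<times> 'v \<times> 'u \<times> 'v \<Rightarrow> 'x \<times> 'y \<times> 'u \<times> 'u \<times> 'v \<times> 'u \<times> 'v" where
  "saddle_field c = (\<lambda>(X, Y, U, W, Z, l, m).
    let D = G Y - c - U; X' = P' m; Y' = - G' D - R' m; U' = D - l
    in (X', Y', U', L1 l, L2 m, U + U' - L1 W - L1 l, R Y + R Y' - P X - L2 Z - L2 m - P X'))"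

definition residual :: "'x \<times> 'y \<times> 'u \<times> 'u \<times> 'v \<times> 'u \<times> 'v \<Rightarrow> 'u" where
  "residual = (\<lambda>(X, Y, U, _). G Y - U)"

lemmas op_add = linear_ops[THEN linear_add]
lemmas op_diff = linear_ops[THEN linear_diff]
lemmas op_neg = linear_ops[THEN linear_neg]
lemmas op_scale = linear_ops[THEN linear_scale]
lemmas op_0 = linear_ops[THEN linear_0]

lemma saddle_field_diff: "saddle_field c z - saddle_field c z' = saddle_field 0 (z - z')"
  by (auto simp: saddle_field_def Let_def case_prod_unfold op_diff op_add op_neg)

lemma linear_saddle_field: "linear (saddle_field 0)"
proof
  show "saddle_field 0 (z + z') = saddle_field 0 z + saddle_field 0 z'" for z z'
    using saddle_field_diff[of 0 "z + z'" z'] by (simp add: algebra_simps)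
  show "saddle_field 0 (r *\<^sub>R z) = r *\<^sub>R saddle_field 0 z" for r z
    by (simp add: saddle_field_def Let_def case_prod_unfold op_scale op_add op_diff op_neg
        scaleR_prod_def algebra_simps)
qed

lemma linear_residual: "linear residual"
  by (rule linearI) (auto simp: residual_def case_prod_unfold op_scale op_add algebra_simps)

text \<open>Explains the choice of \<open>residual\<close>. After the adjoint relations cancel the
  couplings, the plain inner product still contains the indefinite terms
  \<open>(D - l) \<bullet> l\<close> and \<open>R Y' \<bullet> m\<close>. The residual part adds
  \<open>G Y' \<bullet> D - (D - l) \<bullet> D\<close>, completing them to minus the squares of
  \<open>D - l\<close> and \<open>Y' = - G' D - R' m\<close>.\<close>

lemma dissipation_identity:
  fixes X :: 'x and Y :: 'y and U W l :: 'u and Z m :: 'v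
  defines "e \<equiv> (X, Y, U, W, Z, l, m)" and "D \<equiv> G Y - U"
  shows "e \<bullet> saddle_field 0 e + residual e \<bullet> residual (saddle_field 0 e)
    = - (P' m \<bullet> P' m + (G' D + R' m) \<bullet> (G' D + R' m) + (D - l) \<bullet> (D - l) + D \<bullet> D
        + l \<bullet> L1 l + m \<bullet> L2 m)"
proof -
  define Y' where "Y' = - G' D - R' m"
  have *: "X \<bullet> P' m = P X \<bullet> m" "Y \<bullet> Y' = - (G Y \<bullet> D) - R Y \<bullet> m" "W \<bullet> L1 l = L1 W \<bullet> l"
    "Z \<bullet> L2 m = L2 Z \<bullet> m" "P (P' m) \<bullet> m = P' m \<bullet> P' m"
    "(G Y' \<bullet> D) + R Y' \<bullet> m = - (Y' \<bullet> Y')"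
    by (simp_all add: adjoint_G adjoint_R adjoint_P adjoint_L1 adjoint_L2 Y'_def inner_diff_right)
  have "e \<bullet> saddle_field 0 e + residual e \<bullet> residual (saddle_field 0 e)
    = X \<bullet> P' m + Y \<bullet> Y' + U \<bullet> (D - l) + W \<bullet> L1 l + Z \<bullet> L2 m + (U + (D - l) - L1 W - L1 l) \<bullet> l
      + (R Y + R Y' - P X - L2 Z - L2 m - P (P' m)) \<bullet> m + (G Y' - (D - l)) \<bullet> D"
    by (simp add: e_def D_def Y'_def saddle_field_def residual_def Let_def inner_commute)
  also have "\<dots> = - (P' m \<bullet> P' m + Y' \<bullet> Y' + (D - l) \<bullet> (D - l) + D \<bullet> D + l \<bullet> L1 l + m \<bullet> L2 m)"
    using * inner_diff_left[of "G Y" U D, folded D_def] inner_commute[of "L1 l" l]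
      inner_commute[of "L2 m" m]
    unfolding inner_diff_left inner_diff_right inner_add_left by linarith
  finally show ?thesis
    by (simp add: Y'_def inner_diff_left inner_diff_right inner_add_left inner_add_right)
qed

lemma dissipative_saddle: "dissipative_system (saddle_field 0) residual"
proof (rule dissipative_system.intro)
  fix e :: "'x \<times> 'y \<times> 'u \<times> 'u \<times> 'v \<times> 'u \<times> 'v"
  obtain X Y U W Z l m where e: "e = (X, Y, U, W, Z, l, m)" by (metis prod.exhaust)
  define D where "D = G Y - U"
  note id = dissipation_identity[of X Y U W Z l m, folded D_def e]
  note nn = inner_ge_zero[of "P' m"] inner_ge_zero[of "G' D + R' m"] inner_ge_zero[of "D - l"]
    inner_ge_zero[of D] psd_L1(1)[of l] psd_L2(1)[of m]
  show "e \<bullet> saddle_field 0 e + residual e \<bullet> residual (saddle_field 0 e) \<le> 0"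
    using id nn by linarith
  assume "e \<bullet> saddle_field 0 e + residual e \<bullet> residual (saddle_field 0 e) = 0"
  with id nn have "P' m \<bullet> P' m = 0" "(G' D + R' m) \<bullet> (G' D + R' m) = 0" "(D - l) \<bullet> (D - l) = 0"
    "l \<bullet> L1 l = 0" "m \<bullet> L2 m = 0" "D \<bullet> D = 0" by linarith+
  then have z: "P' m = 0" "- G' D - R' m = 0" "D - l = 0" "L1 l = 0" "L2 m = 0" "D = 0"
    using psd_L1(2) psd_L2(2) by (auto simp: neg_eq_iff_add_eq_0)
  \<comment> \<open>Without dissipation at \<open>e\<close> only the multipliers still move; their
    velocities are the constraint violations \<open>l'\<close> and \<open>m'\<close>.\<close>
  define l' where "l' = U - L1 W"
  define m' where "m' = R Y - P X - L2 Z"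
  have Me: "saddle_field 0 e = (0, 0, 0, 0, 0, l', m')"
    using z by (simp add: e saddle_field_def Let_def l'_def m'_def op_0 D_def)
  assume "saddle_field 0 e \<bullet> saddle_field 0 (saddle_field 0 e)
    + residual (saddle_field 0 e) \<bullet> residual (saddle_field 0 (saddle_field 0 e)) = 0"
  \<comment> \<open>At this point \<open>D = 0\<close>, so \<open>D - l'\<close> contributes
    \<open>l' \<bullet> l'\<close>. Hence \<open>l' = 0\<close>, and \<open>m'\<close> lies in the
    kernels of \<open>P'\<close>, \<open>R'\<close> and \<open>L2\<close>, where the field
    vanishes.\<close>
  with dissipation_identity[of 0 0 0 0 0 l' m']
  have "P' m' \<bullet> P' m' + R' m' \<bullet> R' m' + l' \<bullet> l' + l' \<bullet> L1 l' + m' \<bullet> L2 m' = 0"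
    by (simp add: Me op_0)
  with inner_ge_zero[of "P' m'"] inner_ge_zero[of "R' m'"] inner_ge_zero[of l']
    psd_L1(1)[of l'] psd_L2(1)[of m']
  have "P' m' \<bullet> P' m' = 0" "R' m' \<bullet> R' m' = 0" "l' \<bullet> l' = 0" "m' \<bullet> L2 m' = 0" by linarith+
  then have "P' m' = 0" "R' m' = 0" "l' = 0" "L2 m' = 0" using psd_L2(2) by auto
  then show "saddle_field 0 (saddle_field 0 e) = 0"
    unfolding Me by (simp add: saddle_field_def Let_def op_0 zero_prod_def)
qed (rule linear_saddle_field linear_residual)+

lemma dissipative_affine_saddle:
  assumes "equilibrium (saddle_field c) z0"
  shows "dissipative_affine_system (saddle_field 0) residual (saddle_field c) z0"
  using assms dissipative_saddle saddle_field_diff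
  by (simp add: dissipative_affine_system_def dissipative_affine_system_axioms_def)

text \<open>Karush-Kuhn-Tucker conditions of the Lagrangian: stationarity in the five primal
  variables and the two constraints. Velocity feedback and damping vanish at rest.\<close>

lemma equilibrium_saddle_iff:
  "equilibrium (saddle_field c) (X, Y, U, W, Z, l, m) \<longleftrightarrow>
    P' m = 0 \<and> G' l + R' m = 0 \<and> G Y - c - U = l \<and> L1 l = 0 \<and> L2 m = 0 \<and> U = L1 W \<and> R Y - P X = L2 Z"
  (is "?l \<longleftrightarrow> ?r")
proof
  show "?r \<Longrightarrow> ?l"
    by (simp add: equilibrium_def saddle_field_def Let_def zero_prod_def op_0 neg_eq_iff_add_eq_0 )
       (simp add: algebra_simps op_0 flip: eq_neg_iff_add_eq_0)
  assume ?l
  then have eqs: "P' m = 0" "- G' (G Y - c - U) - R' m = 0" "G Y - c - U - l = 0" "L1 l = 0" "L2 m = 0"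
    "U + (G Y - c - U - l) - L1 W - L1 l = 0"
    "R Y + R (- G' (G Y - c - U) - R' m) - P X - L2 Z - L2 m - P (P' m) = 0"
    unfolding equilibrium_def saddle_field_def Let_def zero_prod_def case_prod_conv prod.inject
    by blast+
  have l: "G Y - c - U = l" using eqs(3) by simp
  have "- (G' l + R' m) = 0" using eqs(2) unfolding l by simp
  moreover have "U - L1 W = 0" using eqs(6) unfolding eqs(3,4) by simp
  moreover have "R Y - P X - L2 Z = 0" using eqs(7) unfolding eqs(1,2,5) by (simp add: op_0)
  ultimately show ?r using eqs(1,4,5) l by (simp only: neg_equal_0_iff_equal right_minus_eq simp_thms)
qed

end

section \<open>Graph Laplacian\<close>

definition laplacian :: "('n::finite \<Rightarrow> 'n \<Rightarrow> real) \<Rightarrow> 'v::euclidean_space^'n \<Rightarrow> 'v^'n" where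
  "laplacian a W = (\<chi> i. \<Sum>j\<in>UNIV. a i j *\<^sub>R (W $ i - W $ j))"

lemma linear_laplacian: "linear (laplacian a :: 'v::euclidean_space^'n::finite \<Rightarrow> _)"
proof (rule linearI; unfold laplacian_def vec_eq_iff, intro allI)
  fix V W :: "'v^'n" and i :: 'n
  show "(\<chi> i. \<Sum>j\<in>UNIV. a i j *\<^sub>R ((V + W) $ i - (V + W) $ j)) $ i
    = ((\<chi> i. \<Sum>j\<in>UNIV. a i j *\<^sub>R (V $ i - V $ j)) + (\<chi> i. \<Sum>j\<in>UNIV. a i j *\<^sub>R (W $ i - W $ j))) $ i"
    by (simp add: add_diff_add scaleR_add_right sum.distrib)
next
  fix r and W :: "'v^'n" and i :: 'n
  show "(\<chi> i. \<Sum>j\<in>UNIV. a i j *\<^sub>R ((r *\<^sub>R W) $ i - (r *\<^sub>R W) $ j)) $ i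
    = (r *\<^sub>R (\<chi> i. \<Sum>j\<in>UNIV. a i j *\<^sub>R (W $ i - W $ j))) $ i"
    by (simp add: scaleR_sum_right scaleR_diff_right mult.commute)
qed

locale connected_weights =
  fixes E :: "'n::finite set set" and a :: "'n \<Rightarrow> 'n \<Rightarrow> real"
  assumes adjacency: "adjacency_matrix E a" and connected: "connected_graph E"
begin

lemma weight_sym: "a i j = a j i"
  using adjacency by (simp add: adjacency_matrix_def)

lemma weight_nonneg: "a i j \<ge> 0"
  using adjacency unfolding adjacency_matrix_def by (metis less_imp_le order_refl)

text \<open>Exchanging \<open>i\<close> and \<open>j\<close> by symmetry of the weights and
  averaging yields the Dirichlet form, from which self-adjointness and nonnegativity are read
  off.\<close>

lemma laplacian_inner:
  "laplacian a W \<bullet> V = (\<Sum>i\<in>UNIV. \<Sum>j\<in>UNIV. a i j * ((W $ i - W $ j) \<bullet> (V $ i - V $ j))) / 2"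
proof -
  have 1: "laplacian a W \<bullet> V = (\<Sum>i\<in>UNIV. \<Sum>j\<in>UNIV. a i j * ((W $ i - W $ j) \<bullet> V $ i))"
    by (simp add: laplacian_def inner_vec_def inner_sum_left)
  also have "\<dots> = (\<Sum>j\<in>UNIV. \<Sum>i\<in>UNIV. a i j * ((W $ i - W $ j) \<bullet> V $ i))" by (rule sum.swap)
  also have "\<dots> = (\<Sum>i\<in>UNIV. \<Sum>j\<in>UNIV. - (a i j * ((W $ i - W $ j) \<bullet> V $ j)))"
    by (intro sum.cong refl) (subst weight_sym, simp add: inner_diff_left algebra_simps)
  finally have "2 * (laplacian a W \<bullet> V) = (\<Sum>i\<in>UNIV. \<Sum>j\<in>UNIV. a i j * ((W $ i - W $ j) \<bullet> V $ i))
    + (\<Sum>i\<in>UNIV. \<Sum>j\<in>UNIV. - (a i j * ((W $ i - W $ j) \<bullet> V $ j)))" using 1 by simp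
  also have "\<dots> = (\<Sum>i\<in>UNIV. \<Sum>j\<in>UNIV. a i j * ((W $ i - W $ j) \<bullet> (V $ i - V $ j)))"
    by (simp add: sum.distrib[symmetric] inner_diff_right right_diff_distrib)
  finally show ?thesis by simp
qed

lemma laplacian_self_adjoint: "laplacian a W \<bullet> V = W \<bullet> laplacian a V"
  unfolding inner_commute[of W "laplacian a V"] laplacian_inner by (simp add: inner_commute)

lemma laplacian_nonneg: "W \<bullet> laplacian a W \<ge> 0"
  unfolding inner_commute[of W] laplacian_inner
  by (intro divide_nonneg_nonneg sum_nonneg mult_nonneg_nonneg weight_nonneg inner_ge_zero) simp

text \<open>A vanishing sum of nonnegative terms vanishes edge by edge, and connectedness chains the
  equalities along a path.\<close>

lemma laplacian_form_zero:
  assumes "W \<bullet> laplacian a W = 0"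
  shows "W $ i = W $ j"
proof -
  have nn: "a i j * ((W $ i - W $ j) \<bullet> (W $ i - W $ j)) \<ge> 0" for i j
    by (simp add: weight_nonneg)
  have "(\<Sum>i\<in>UNIV. \<Sum>j\<in>UNIV. a i j * ((W $ i - W $ j) \<bullet> (W $ i - W $ j))) = 0"
    using assms by (simp add: inner_commute[of W] laplacian_inner)
  then have "a i j * ((W $ i - W $ j) \<bullet> (W $ i - W $ j)) = 0" for i j
    using nn by (simp add: sum_nonneg_eq_0_iff sum_nonneg del: mult_eq_0_iff)
  moreover have "a i j > 0" if "{i, j} \<in> E" for i j
    using that adjacency unfolding adjacency_matrix_def by (metis insert_commute)
  ultimately have edge: "W $ i = W $ j" if "{i, j} \<in> E" for i j
    using that by (metis less_irrefl mult_eq_0_iff inner_eq_zero_iff right_minus_eq)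
  have "(i, j) \<in> {(u, v). {u, v} \<in> E}\<^sup>*" using connected by (simp add: connected_graph_def)
  then show ?thesis by (induction rule: rtrancl_induct) (auto dest: edge)
qed

lemma laplacian_form_zero_imp: "W \<bullet> laplacian a W = 0 \<Longrightarrow> laplacian a W = 0"
proof -
  assume "W \<bullet> laplacian a W = 0"
  then have "a i j *\<^sub>R (W $ i - W $ j) = 0" for i j
    by (metis laplacian_form_zero right_minus_eq scaleR_zero_right)
  then show ?thesis by (simp only: laplacian_def vec_eq_iff vec_lambda_beta sum.neutral_const zero_index simp_thms)
qed

lemma laplacian_kernel:
  assumes "laplacian a W = 0"
  obtains v where "W = (\<chi> i. v)"
\<comment> \<open>\<open>undefined\<close> stands for an arbitrary node.\<close>
proof (rule that[of "W $ undefined"])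
  have "W \<bullet> laplacian a W = 0" using assms by simp
  then show "W = (\<chi> i. W $ undefined)" using laplacian_form_zero by (metis vec_eq_iff vec_lambda_beta)
qed

lemma laplacian_const: "laplacian a (\<chi> i. v) = 0"
  by (simp add: laplacian_def vec_eq_iff)

text \<open>The range of a self-adjoint operator is the orthogonal complement of its kernel, here
  the constant families. Conversely, the part \<open>z\<close> of \<open>V\<close> orthogonal to the
  range is constant, hence orthogonal to \<open>V\<close> as well, so it is 0.\<close>

lemma laplacian_range: "(\<exists>W. V = laplacian a W) \<longleftrightarrow> (\<Sum>i\<in>UNIV. V $ i) = 0"
proof
  assume "\<exists>W. V = laplacian a W"
  then obtain W where W: "V = laplacian a W" ..
  have "(\<Sum>i\<in>UNIV. V $ i) \<bullet> v = 0" for v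
    using laplacian_self_adjoint[of W "\<chi> i. v"]
    by (simp add: laplacian_const W inner_sum_left) (simp add: inner_vec_def)
  from this[of "\<Sum>i\<in>UNIV. V $ i"] show "(\<Sum>i\<in>UNIV. V $ i) = 0" by simp
next
  assume s: "(\<Sum>i\<in>UNIV. V $ i) = 0"
  obtain y z where yz: "y \<in> span (range (laplacian a))"
    "\<And>w. w \<in> span (range (laplacian a)) \<Longrightarrow> orthogonal z w" "V = y + z"
    using orthogonal_subspace_decomp_exists[of "range (laplacian a)" V] by metis
  have sp: "span (range (laplacian a)) = range (laplacian a)"
    by (simp add: linear_laplacian linear_subspace_image)
  have "z \<bullet> laplacian a z = 0" using yz(2)[of "laplacian a z"] by (simp add: span_base orthogonal_def)
  then obtain v where v: "z = (\<chi> i. v)" using laplacian_kernel laplacian_form_zero_imp by blast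
  have "V \<bullet> z = 0" using s unfolding v inner_vec_def by (simp flip: inner_sum_left)
  moreover have "z \<bullet> y = 0" using yz(1,2) by (simp add: orthogonal_def)
  ultimately have "z = 0" unfolding yz(3) by (simp add: inner_add_left inner_add_right inner_commute)
  then show "\<exists>W. V = laplacian a W" using yz(1,3) unfolding sp by auto
qed

end

section \<open>Matrix products and blocks\<close>

lemma inner_matrix_mult_left: "(M ** N) \<bullet> V = N \<bullet> (transpose M ** V)"
  for M :: "real^'k^'m" and N :: "real^'q^'k"
proof -
  have "(M ** N) \<bullet> V = (\<Sum>i\<in>UNIV. \<Sum>k\<in>UNIV. \<Sum>j\<in>UNIV. M$i$k * N$k$j * V$i$j)"
    by (simp add: inner_vec_def matrix_matrix_mult_def sum_distrib_right) (subst sum.swap, rule refl)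
  also have "\<dots> = (\<Sum>k\<in>UNIV. \<Sum>j\<in>UNIV. \<Sum>i\<in>UNIV. M$i$k * N$k$j * V$i$j)"
    by (subst sum.swap) (rule sum.cong[OF refl sum.swap])
  also have "\<dots> = N \<bullet> (transpose M ** V)"
    by (simp add: inner_vec_def matrix_matrix_mult_def sum_distrib_left transpose_def mult_ac)
  finally show ?thesis .
qed

lemma inner_transpose: "transpose M \<bullet> transpose N = M \<bullet> N" for M :: "real^'k^'m"
  by (simp add: inner_vec_def transpose_def) (rule sum.swap)

lemma inner_matrix_mult_right: "(M ** N) \<bullet> V = M \<bullet> (V ** transpose N)"
  for M :: "real^'k^'m" and N :: "real^'q^'k"
proof -
  have "(M ** N) \<bullet> V = (transpose N ** transpose M) \<bullet> transpose V"
    by (simp add: inner_transpose flip: matrix_transpose_mul)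
  also have "\<dots> = transpose M \<bullet> transpose (V ** transpose N)"
    by (simp add: inner_matrix_mult_left matrix_transpose_mul)
  finally show ?thesis by (simp only: inner_transpose)
qed

lemma linear_row_block: "linear (row_block \<beta> i)"
  by (rule linearI) (auto simp: row_block_def vec_eq_iff)

lemma linear_col_block: "linear (col_block \<beta> i)"
  by (rule linearI) (auto simp: col_block_def vec_eq_iff)

lemma linear_matrix_mult_right: "linear (\<lambda>N. M ** N)" for M :: "real^'k^'m"
  by (rule linearI) (simp_all add: matrix_add_ldistrib matrix_scalar_ac scalar_matrix_assoc)

lemma linear_matrix_mult_left: "linear (\<lambda>M. M ** N)" for N :: "real^'q^'k"
  by (rule linearI) (simp_all add: scalar_matrix_assoc,
      simp add: matrix_matrix_mult_def vec_eq_iff sum.distrib distrib_right)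

lemma row_block_mult: "row_block \<beta> i M ** N = row_block \<beta> i (M ** N)"
  by (auto simp: row_block_def matrix_matrix_mult_def vec_eq_iff)

lemma mult_col_block: "M ** col_block \<beta> i N = col_block \<beta> i (M ** N)"
  by (auto simp: col_block_def matrix_matrix_mult_def vec_eq_iff)

text \<open>Both masks act on the summation index, so padding one factor has the same effect as
  padding the other.\<close>

lemma col_block_mult: "col_block \<beta> i M ** N = M ** row_block \<beta> i N"
  by (auto simp: col_block_def row_block_def matrix_matrix_mult_def vec_eq_iff intro!: sum.cong)

lemma row_block_row_block: "row_block \<beta> i (row_block \<beta> j M) = (if i = j then row_block \<beta> i M else 0)"
  by (auto simp: row_block_def vec_eq_iff)

lemma col_block_col_block: "col_block \<beta> i (col_block \<beta> j M) = (if i = j then col_block \<beta> i M else 0)"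
  by (auto simp: col_block_def vec_eq_iff)

lemma transpose_row_block: "transpose (row_block \<beta> i M) = col_block \<beta> i (transpose M)"
  by (simp add: row_block_def col_block_def transpose_def vec_eq_iff)

lemma transpose_col_block: "transpose (col_block \<beta> i M) = row_block \<beta> i (transpose M)"
  by (simp add: row_block_def col_block_def transpose_def vec_eq_iff)

lemma sum_row_block: "(\<Sum>i\<in>UNIV. row_block \<beta> i M) = M"
  by (simp add: row_block_def vec_eq_iff)

lemma sum_col_block: "(\<Sum>i\<in>UNIV. col_block \<beta> i M) = M"
  by (simp add: col_block_def vec_eq_iff)

lemma row_block_sum: "row_block \<beta> i (\<Sum>j\<in>UNIV. row_block \<beta> j (M j)) = row_block \<beta> i (M i)"
  by (simp add: linear_sum[OF linear_row_block] row_block_row_block)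

lemma col_block_sum: "col_block \<beta> i (\<Sum>j\<in>UNIV. col_block \<beta> j (M j)) = col_block \<beta> i (M i)"
  by (simp add: linear_sum[OF linear_col_block] col_block_col_block)

lemma inner_row_block: "row_block \<beta> i M \<bullet> N = M \<bullet> row_block \<beta> i N"
  by (auto simp: row_block_def inner_vec_def intro!: sum.cong)

lemma inner_col_block: "col_block \<beta> i M \<bullet> N = M \<bullet> col_block \<beta> i N"
  by (auto simp: col_block_def inner_vec_def intro!: sum.cong)

section \<open>Normal equations\<close>

lemma inner_two_sided_mult:
  "(A ** X ** B) \<bullet> V = X \<bullet> (transpose A ** V ** transpose B)"
  for A :: "real^'r^'m" and B :: "real^'q^'p"
  unfolding inner_matrix_mult_right[of "A ** X"] inner_matrix_mult_left[of A X] matrix_mul_assoc ..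

lemma linear_two_sided_mult: "linear (\<lambda>X. A ** X ** B)"
  for A :: "real^'r^'m" and B :: "real^'q^'p"
  using linear_compose[OF linear_matrix_mult_right linear_matrix_mult_left] by (simp add: o_def)

text \<open>The hypothesis makes the residual orthogonal to every \<open>A ** H ** B\<close>, so
  Pythagoras applies to any competitor.\<close>

lemma least_squares_if_normal:
  fixes A :: "real^'r^'m" and B :: "real^'q^'p" and F :: "real^'q^'m"
  assumes "transpose A ** (A ** X ** B - F) ** transpose B = 0"
  shows "least_squares_solution A B F X"
proof -
  have "(norm (A ** X ** B - F))\<^sup>2 \<le> (norm (A ** Y ** B - F))\<^sup>2" for Y
  proof -
    have split: "A ** Y ** B - F = (A ** X ** B - F) + A ** (Y - X) ** B"
      by (simp add: linear_diff[OF linear_two_sided_mult])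
    have "(A ** (Y - X) ** B) \<bullet> (A ** X ** B - F) = 0"
      by (simp add: inner_two_sided_mult assms)
    then have "(norm (A ** Y ** B - F))\<^sup>2
        = (norm (A ** X ** B - F))\<^sup>2 + (norm (A ** (Y - X) ** B))\<^sup>2"
      unfolding split by (intro norm_add_Pythagorean) (simp add: orthogonal_def inner_commute)
    then show ?thesis by simp
  qed
  then show ?thesis by (auto simp: least_squares_solution_def is_arg_min_def not_less)
qed

text \<open>A preimage of the orthogonal projection of \<open>F\<close> onto the range of
  \<open>X \<mapsto> A ** X ** B\<close> is a solution.\<close>

lemma normal_equations_solvable:
  fixes A :: "real^'r^'m" and B :: "real^'q^'p" and F :: "real^'q^'m"
  obtains X where "transpose A ** (A ** X ** B - F) ** transpose B = 0"
proof -
  let ?T = "\<lambda>X. A ** X ** B"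
  obtain y z where yz: "y \<in> span (range ?T)" "\<And>w. w \<in> span (range ?T) \<Longrightarrow> orthogonal z w" "F = y + z"
    using orthogonal_subspace_decomp_exists[of "range ?T" F] by metis
  have "span (range ?T) = range ?T"
    by (simp only: span_eq_iff linear_subspace_image[OF linear_two_sided_mult subspace_UNIV])
  with yz(1) obtain X where X: "y = A ** X ** B" by blast
  have "H \<bullet> (transpose A ** (A ** X ** B - F) ** transpose B) = 0" for H
    using yz(2)[of "?T H"] yz(3) X
    by (simp add: span_base orthogonal_def inner_commute flip: inner_two_sided_mult)
  then show ?thesis using that inner_eq_zero_iff by blast
qed

section \<open>Equilibria\<close>

locale crr_system = connected_weights E a
  for E :: "'n::finite set set" and a +
  fixes A :: "real^'r::finite^'m::finite" and B :: "real^'q::finite^'p::finite" and F :: "real^'q^'m"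
    and \<rho> :: "'r \<Rightarrow> 'n" and \<pi> :: "'p \<Rightarrow> 'n" and \<phi> :: "'m \<Rightarrow> 'n"
begin

text \<open>\<open>G\<close>, \<open>R\<close>, \<open>P\<close> and their adjoints are the
  operators of the Lagrangian. As masking one factor of a product suffices, \<open>A\<close> and
  \<open>B\<close> appear without block restrictions.\<close>

definition G :: "real^'q^'r \<Rightarrow> real^'q^'m^'n" where
  "G Y = (\<chi> i. A ** row_block \<rho> i Y)"

definition G' :: "real^'q^'m^'n \<Rightarrow> real^'q^'r" where
  "G' V = (\<Sum>i\<in>UNIV. row_block \<rho> i (transpose A ** V $ i))"

definition R :: "real^'q^'r \<Rightarrow> real^'q^'r^'n" where
  "R Y = (\<chi> i. row_block \<rho> i Y)"

definition R' :: "real^'q^'r^'n \<Rightarrow> real^'q^'r" where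
  "R' V = (\<Sum>i\<in>UNIV. row_block \<rho> i (V $ i))"

definition P :: "real^'p^'r \<Rightarrow> real^'q^'r^'n" where
  "P X = (\<chi> i. col_block \<pi> i X ** B)"

definition P' :: "real^'q^'r^'n \<Rightarrow> real^'p^'r" where
  "P' V = (\<Sum>i\<in>UNIV. col_block \<pi> i (V $ i ** transpose B))"

lemmas block_linear = linear_row_block linear_col_block linear_matrix_mult_left linear_matrix_mult_right

lemma linear_G: "linear G"
  by (rule linearI) (simp_all add: G_def vec_eq_iff[where 'b = 'n] block_linear[THEN linear_add] block_linear[THEN linear_scale])

lemma linear_G': "linear G'"
  by (rule linearI) (simp_all add: G'_def block_linear[THEN linear_add] block_linear[THEN linear_scale]
      sum.distrib scaleR_sum_right)

lemma linear_R: "linear R"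
  by (rule linearI) (simp_all add: R_def vec_eq_iff[where 'b = 'n] block_linear[THEN linear_add] block_linear[THEN linear_scale])

lemma linear_R': "linear R'"
  by (rule linearI) (simp_all add: R'_def block_linear[THEN linear_add] block_linear[THEN linear_scale]
      sum.distrib scaleR_sum_right)

lemma linear_P: "linear P"
  by (rule linearI) (simp_all add: P_def vec_eq_iff[where 'b = 'n] block_linear[THEN linear_add] block_linear[THEN linear_scale])

lemma linear_P': "linear P'"
  by (rule linearI) (simp_all add: P'_def block_linear[THEN linear_add] block_linear[THEN linear_scale]
      sum.distrib scaleR_sum_right)

sublocale saddle_system G G' R R' P P' "laplacian a" "laplacian a"
proof (rule saddle_system.intro)
  show "G Y \<bullet> V = Y \<bullet> G' V" for Y V
    by (simp add: G_def G'_def inner_vec_def[where 'b = 'n] inner_sum_right inner_matrix_mult_left inner_row_block)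
  show "R Y \<bullet> V = Y \<bullet> R' V" for Y V
    by (simp add: R_def R'_def inner_vec_def[where 'b = 'n] inner_sum_right inner_row_block)
  show "P X \<bullet> V = X \<bullet> P' V" for X V
    by (simp add: P_def P'_def inner_vec_def[where 'b = 'n] inner_sum_right inner_matrix_mult_right inner_col_block)
qed (rule linear_G linear_G' linear_R linear_R' linear_P linear_P' linear_laplacian
    laplacian_self_adjoint laplacian_nonneg | erule laplacian_form_zero_imp)+

section \<open>Identification with the saddle point dynamics\<close>

definition blocks_F :: "real^'q^'m^'n" where
  "blocks_F = (\<chi> i. row_block \<phi> i F)"

lemma crr_field_eq_saddle_field: "crr_field A B F \<rho> \<pi> \<phi> a = saddle_field blocks_F"
proof (rule ext, clarify)
  fix X Y U W Z l m
  define D where "D = G Y - blocks_F - U"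
  have mult: "col_block \<rho> i A ** row_block \<rho> i Y = A ** row_block \<rho> i Y"
    "col_block \<pi> i X ** row_block \<pi> i B = col_block \<pi> i X ** B" for i X Y
    by (simp_all add: col_block_mult row_block_row_block)
  have D: "col_block \<rho> i A ** row_block \<rho> i Y - row_block \<phi> i F - U $ i = D $ i" for i
    by (simp add: D_def G_def blocks_F_def mult)
  have dY: "- (transpose (col_block \<rho> i A) ** D $ i) - row_block \<rho> i (m $ i)
      = row_block \<rho> i (- (transpose A ** D $ i) - m $ i)" for i
    by (simp add: transpose_col_block row_block_mult linear_diff[OF linear_row_block] linear_neg[OF linear_row_block])
  have dX: "m $ i ** transpose (row_block \<pi> i B) = col_block \<pi> i (m $ i ** transpose B)" for i
    by (simp add: transpose_row_block mult_col_block)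
  have Y': "(\<Sum>i\<in>UNIV. row_block \<rho> i (- (transpose A ** D $ i) - m $ i)) = - G' D - R' m"
    by (simp add: G'_def R'_def linear_diff[OF linear_row_block] linear_neg[OF linear_row_block]
        sum_subtractf sum_negf)
  have X': "(\<Sum>i\<in>UNIV. col_block \<pi> i (m $ i ** transpose B)) = P' m" by (simp add: P'_def)
  \<comment> \<open>The feedback in the multiplier equations uses velocities of single blocks; they
    are recovered as blocks of the assembled velocities.\<close>
  have RY': "row_block \<rho> i (- (transpose A ** D $ i) - m $ i) = R (- G' D - R' m) $ i" for i
    unfolding Y'[symmetric] by (simp add: R_def row_block_sum)
  have PX': "col_block \<pi> i (m $ i ** transpose B) ** row_block \<pi> i B = P (P' m) $ i" for i
    unfolding X'[symmetric] by (simp add: P_def mult(2) col_block_sum)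
  show "crr_field A B F \<rho> \<pi> \<phi> a (X, Y, U, W, Z, l, m) = saddle_field blocks_F (X, Y, U, W, Z, l, m)"
    unfolding crr_field_def saddle_field_def Let_def case_prod_conv D dY dX PX' D_def[symmetric] Y' X' prod.inject
    by (simp add: vec_eq_iff[where 'b = 'n] laplacian_def RY' mult) (simp add: R_def P_def)
qed

section \<open>Summation over the nodes and the normal equations\<close>

lemma sum_G: "(\<Sum>i\<in>UNIV. G Y $ i) = A ** Y"
  by (simp add: G_def sum_row_block flip: linear_sum[OF linear_matrix_mult_right])

lemma sum_R: "(\<Sum>i\<in>UNIV. R Y $ i) = Y"
  by (simp add: R_def sum_row_block)

lemma sum_P: "(\<Sum>i\<in>UNIV. P X $ i) = X ** B"
  by (simp add: P_def sum_col_block flip: linear_sum[OF linear_matrix_mult_left])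

lemma sum_blocks_F: "(\<Sum>i\<in>UNIV. blocks_F $ i) = F"
  by (simp add: blocks_F_def sum_row_block)

text \<open>Equilibrium multipliers are constant families, on which the adjoints reassemble full
  matrices.\<close>

lemma const_adjoints:
  "G' (\<chi> i. V) = transpose A ** V" "R' (\<chi> i. N) = N" "P' (\<chi> i. N) = N ** transpose B"
  by (simp_all add: G'_def R'_def P'_def sum_row_block sum_col_block)

lemma equilibrium_least_squares:
  assumes "equilibrium (crr_field A B F \<rho> \<pi> \<phi> a) z"
  shows "least_squares_solution A B F (fst z)"
proof -
  obtain X Y U W Z l m where z: "z = (X, Y, U, W, Z, l, m)" by (metis prod.exhaust)
  have eqs: "P' m = 0" "G' l + R' m = 0" "G Y - blocks_F - U = l" "laplacian a l = 0"
    "laplacian a m = 0" "U = laplacian a W" "R Y - P X = laplacian a Z"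
    using assms unfolding z crr_field_eq_saddle_field equilibrium_saddle_iff by blast+
  obtain V where V: "l = (\<chi> i. V)" using laplacian_kernel eqs(4) .
  obtain N where N: "m = (\<chi> i. N)" using laplacian_kernel eqs(5) .
  \<comment> \<open>\<open>N\<close> is eliminated between stationarity in \<open>Y\<close> and
    stationarity in \<open>X\<close>.\<close>
  have normal: "transpose A ** V ** transpose B = 0"
  proof -
    have "transpose A ** V = - N" using eqs(2) by (simp add: V N const_adjoints eq_neg_iff_add_eq_0)
    moreover have "N ** transpose B = 0" using eqs(1) by (simp add: N const_adjoints)
    ultimately show ?thesis using linear_neg[OF linear_matrix_mult_left, of N "transpose B"] by simp
  qed
  \<comment> \<open>Images of the Laplacian sum to zero, so summation removes \<open>U\<close> and
    turns the second constraint into \<open>Y = X ** B\<close>; the residual is then a multiple of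
    \<open>V\<close>.\<close>
  have "(\<Sum>i\<in>UNIV. U $ i) = 0" using laplacian_range eqs(6) by blast
  moreover have "(\<Sum>i\<in>UNIV. (G Y - blocks_F - U) $ i) = real CARD('n) *\<^sub>R V"
    by (simp add: eqs(3) V sum_constant_scaleR del: sum_constant)
  ultimately have "A ** Y - F = real CARD('n) *\<^sub>R V" by (simp add: sum_subtractf sum_G sum_blocks_F)
  moreover have "(\<Sum>i\<in>UNIV. (R Y - P X) $ i) = 0" using laplacian_range eqs(7) by blast
  then have "Y = X ** B" by (simp add: sum_subtractf sum_R sum_P)
  ultimately have "A ** X ** B - F = real CARD('n) *\<^sub>R V" by (simp add: matrix_mul_assoc)
  with normal have "transpose A ** (A ** X ** B - F) ** transpose B = 0"
    by (simp add: linear_scale[OF linear_two_sided_mult])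
  then show ?thesis by (simp add: z least_squares_if_normal)
qed

lemma equilibrium_exists: "\<exists>z. equilibrium (crr_field A B F \<rho> \<pi> \<phi> a) z"
proof -
  obtain X where X: "transpose A ** (A ** X ** B - F) ** transpose B = 0"
    using normal_equations_solvable .
  \<comment> \<open>Every node carries an equal share of the residual; this factor makes the sum of
    \<open>U\<close> vanish, so that \<open>W\<close> exists.\<close>
  define V where "V = (1 / real CARD('n)) *\<^sub>R (A ** X ** B - F)"
  \<comment> \<open>Chosen to give stationarity in \<open>Y\<close>; stationarity in
    \<open>X\<close> then becomes the normal equations.\<close>
  define N where "N = - (transpose A ** V)"
  define l :: "real^'q^'m^'n" where "l = (\<chi> i. V)"
  define m :: "real^'q^'r^'n" where "m = (\<chi> i. N)"
  define Y where "Y = X ** B"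
  define U where "U = G Y - blocks_F - l"
  have "transpose A ** V ** transpose B = 0"
    using X by (simp add: V_def linear_scale[OF linear_two_sided_mult])
  then have "P' m = 0"
    using linear_neg[OF linear_matrix_mult_left, of "transpose A ** V" "transpose B"]
    by (simp add: m_def N_def const_adjoints)
  moreover have "G' l + R' m = 0" by (simp add: l_def m_def N_def const_adjoints)
  moreover have "G Y - blocks_F - U = l" by (simp add: U_def)
  moreover have "laplacian a l = 0" "laplacian a m = 0" by (simp_all add: l_def m_def laplacian_const)
  moreover have "(\<Sum>i\<in>UNIV. U $ i) = 0"
    by (simp add: U_def sum_subtractf sum_G sum_blocks_F l_def V_def Y_def matrix_mul_assoc sum_constant_scaleR
        del: sum_constant)
  then obtain W where "U = laplacian a W" using laplacian_range by blast
  moreover have "(\<Sum>i\<in>UNIV. (R Y - P X) $ i) = 0" by (simp add: sum_subtractf sum_R sum_P Y_def)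
  then obtain Z where "R Y - P X = laplacian a Z" using laplacian_range by blast
  ultimately have "equilibrium (saddle_field blocks_F) (X, Y, U, W, Z, l, m)"
    by (simp add: equilibrium_saddle_iff)
  then show ?thesis unfolding crr_field_eq_saddle_field by blast
qed

end

section \<open>Convergence of the \<open>X\<close> component and conclusion\<close>

lemma converges_exponentially_fst:
  assumes "converges_exponentially x z"
  shows "converges_exponentially (\<lambda>t. fst (x t)) (fst z)"
  using assms unfolding converges_exponentially_def by (meson dist_fst_le order_trans)

theorem mainTheorem9:
  fixes A :: "real^'r::finite^'m::finite" and B :: "real^'q::finite^'p::finite" and F :: "real^'q^'m"
    and \<rho> :: "'r \<Rightarrow> 'n::finite" and \<pi> :: "'p \<Rightarrow> 'n" and \<phi> :: "'m \<Rightarrow> 'n"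
    and E :: "'n set set" and a :: "'n \<Rightarrow> 'n \<Rightarrow> real"
  assumes "undirected_graph E" and "adjacency_matrix E a" and "connected_graph E"
  shows "(\<forall>z. equilibrium (crr_field A B F \<rho> \<pi> \<phi> a) z \<longrightarrow>
              lyapunov_stable (crr_field A B F \<rho> \<pi> \<phi> a) z) \<and>
         (\<forall>x. ode_solution (crr_field A B F \<rho> \<pi> \<phi> a) x \<longrightarrow> bounded (x ` {0..})) \<and>
         (\<forall>x. ode_solution (crr_field A B F \<rho> \<pi> \<phi> a) x \<longrightarrow>
              (\<exists>z. equilibrium (crr_field A B F \<rho> \<pi> \<phi> a) z \<and> converges_exponentially x z) \<and>
              (\<exists>X. least_squares_solution A B F X \<and> converges_exponentially (\<lambda>t. fst (x t)) X))"
proof -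
  interpret crr_system E a A B F \<rho> \<pi> \<phi>
    using assms(2,3) by (simp add: crr_system_def connected_weights_def)
  let ?f = "crr_field A B F \<rho> \<pi> \<phi> a"
  obtain z0 where "equilibrium ?f z0" using equilibrium_exists by blast
  then interpret dissipative_affine_system "saddle_field 0" residual ?f z0
    unfolding crr_field_eq_saddle_field by (rule dissipative_affine_saddle)
  have "\<exists>z. equilibrium ?f z \<and> converges_exponentially x z" if "ode_solution ?f x" for x
    using exponential_convergence[OF that] by blast
  \<comment> \<open>The limit of \<open>X\<close> is the first component of the limiting
    equilibrium, hence a least squares solution.\<close>
  then show ?thesis
    using stable bounded_solution equilibrium_least_squares converges_exponentially_fst by metis
qed

end
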